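(* Let $d\ge 1$. The arcsine transformation $\mathcal{A}_1$ is one-to-one on its domain $\mathfrak{D}(\mathcal{A}_1)$: if $\nu,\nu'\in\mathfrak{D}(\mathcal{A}_1)$ and $\mathcal{A}_1(\nu)=\mathcal{A}_1(\nu')$, then $\nu=\nu'$.
   Context: $\mathfrak{M}_L(\mathbb{R}^d)$ is the class of Lévy measures on $\mathbb{R}^d$: measures $\nu$ with $\nu(\{0\})=0$ and $\int_{\mathbb{R}^d}(1\wedge|x|^2)\,\nu(\mathrm{d}x)<\infty$. $\mathfrak{M}_L^1(\mathbb{R}^d)$ is the class of $\nu\in\mathfrak{M}_L(\mathbb{R}^d)$ with $\int_{\mathbb{R}^d}(1\wedge|x|)\,\nu(\mathrm{d}x)<\infty$. For $s>0$ let $a_1(r;s)=2\pi^{-1}(s-r^2)^{-1/2}1_{(0,s^{1/2})}(r)$. For a measure $\nu$ on $\mathbb{R}^d$ define $$\mathcal{A}_1(\nu)(B)=\int_{\mathbb{R}^d\setminus\{0\}}\nu(\mathrm{d}x)\int_0^\infty a_1(r;|x|)\,1_B\!\left(r\frac{x}{|x|}\right)\mathrm{d}r,\qquad B\in\mathcal{B}(\mathbb{R}^d).$$ The domain $\mathfrak{D}(\mathcal{A}_1)$ is the class of measures $\nu$ on $\mathbb{R}^d$ such that $\nu(\{0\})=0$ and the right-hand side, as a function of $B$, is a measure belonging to $\mathfrak{M}_L(\mathbb{R}^d)$. (It is a fact that $\mathfrak{D}(\mathcal{A}_1)=\mathfrak{M}_L^1(\mathbb{R}^d)$.) *)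

theory Defs
  imports "HOL-Analysis.Analysis"
begin

text \<open>
  \<open>\<real>\<^sup>d\<close> with \<open>d \<ge> 1\<close> is an arbitrary type of class \<^class>\<open>euclidean_space\<close>
  (whose dimension is always positive), and a measure on \<open>\<real>\<^sup>d\<close> is a measure on its Borel sets,
  with values in \<open>[0, \<infinity>]\<close> and without any finiteness assumption.
\<close>

definition levy_measures :: "'a::euclidean_space measure set" where
  "levy_measures = {\<nu>. sets \<nu> = sets borel \<and> emeasure \<nu> {0} = 0 \<and>
     (\<integral>\<^sup>+ x. ennreal (min 1 ((norm x)\<^sup>2)) \<partial>\<nu>) < \<infinity>}"

definition arcsine_density :: "real \<Rightarrow> real \<Rightarrow> real" where
  "arcsine_density r s = 2 / pi * (s - r\<^sup>2) powr (- 1 / 2) * indicator {0<..<s powr (1 / 2)} r"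

definition arcsine_set_fun :: "'a::euclidean_space measure \<Rightarrow> 'a set \<Rightarrow> ennreal" where
  "arcsine_set_fun \<nu> B =
     (\<integral>\<^sup>+ x\<in>UNIV - {0}. (\<integral>\<^sup>+ r\<in>{0<..}.
        ennreal (arcsine_density r (norm x)) * indicator B (r *\<^sub>R (x /\<^sub>R norm x)) \<partial>lborel) \<partial>\<nu>)"

text \<open>
  The constant \<^const>\<open>measure_of\<close> yields the zero measure when its set function is not a measure.
  The definition of the domain therefore states separately that
  \<^term>\<open>arcsine_set_fun \<nu>\<close> is a measure.
\<close>

definition arcsine_transform :: "'a::euclidean_space measure \<Rightarrow> 'a measure" where
  "arcsine_transform \<nu> = measure_of UNIV (sets borel) (arcsine_set_fun \<nu>)"

definition arcsine_domain :: "'a::euclidean_space measure set" where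
  "arcsine_domain = {\<nu>. sets \<nu> = sets borel \<and> emeasure \<nu> {0} = 0 \<and>
     measure_space UNIV (sets borel) (arcsine_set_fun \<nu>) \<and>
     arcsine_transform \<nu> \<in> levy_measures}"

lemma sets_arcsine_transform: "sets (arcsine_transform \<nu>) = sets borel"
  unfolding arcsine_transform_def
  by (metis sets.sets_measure_of_eq space_borel)

lemma emeasure_arcsine_transform:
  assumes "\<nu> \<in> arcsine_domain" and "B \<in> sets borel"
  shows "emeasure (arcsine_transform \<nu>) B = arcsine_set_fun \<nu> B"
proof -
  have "measure_space UNIV (sets borel) (arcsine_set_fun \<nu>)"
    using assms(1) by (simp add: arcsine_domain_def)
  then show ?thesis
    unfolding arcsine_transform_def measure_space_def
    using assms(2) by (intro emeasure_measure_of_sigma) auto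
qed

end

theory Submission
  imports Defs
begin

text \<open>
  Abel's integral equation explains the injectivity. On a ray, the transformation replaces a unit
  mass at distance \<open>s\<close> by the probability density \<open>2 / (\<pi> \<surd>(s - r\<^sup>2))\<close> on
  \<open>0 < r < \<surd>s\<close>. In the variable \<open>v = r\<^sup>2\<close> this is an Abel kernel of order \<open>1/2\<close>, and composing two
  such kernels gives a step function: for \<open>0 < t < s\<close>
    \<open>\<integral>\<^sub>t\<^sup>s dv / (\<surd>(s - v) \<surd>(v - t)) = B(1/2, 1/2) = \<pi>\<close>,
  independently of \<open>s\<close> and \<open>t\<close>. Hence the function \<open>h\<^sub>t(r) = r / \<surd>(r\<^sup>2 - t)\<close> on \<open>r > \<surd>t\<close> has
  arcsine average \<open>1\<close> when \<open>s > t\<close> and \<open>0\<close> otherwise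
  (\<open>nn_integral_arcsine_density_abel_kernel\<close>). Integrating \<open>h\<^sub>t(|y|) 1\<^sub>C(y/|y|)\<close> against the
  transform of \<open>\<nu>\<close> therefore recovers \<open>\<nu> {x. |x| > t, x/|x| \<in> C}\<close>
  (\<open>nn_integral_abel_kernel_arcsine_transform\<close>). All integrands are nonnegative, so this inversion
  formula is an identity in \<open>[0, \<infinity>]\<close>, and no derivative is taken.

  It remains to see that these polar tails determine \<open>\<nu>\<close> (\<open>measure_eq_polar_tails\<close>). They form a
  \<open>\<pi>\<close>-system in polar coordinates, so what is needed is that they have finite mass. This
  follows from the Levy property of the transform, because the arcsine density leaves a fixed
  proportion of the mass of a point at distance \<open>s\<close> beyond \<open>\<surd>s/2\<close>
  (\<open>arcsine_domain_tail_finite\<close>).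
\<close>

section \<open>Integration against the arcsine transform\<close>

definition arcsine_avg :: "('a::euclidean_space \<Rightarrow> ennreal) \<Rightarrow> 'a \<Rightarrow> ennreal" where
  "arcsine_avg f x = (\<integral>\<^sup>+ r. ennreal (arcsine_density r (norm x)) * indicator {0<..} r *
     f (r *\<^sub>R sgn x) \<partial>lborel)"

lemma measurable_arcsine_density [measurable]: "(\<lambda>(r, s). arcsine_density r s) \<in> borel_measurable (borel \<Otimes>\<^sub>M borel)"
proof -
  have "(\<lambda>(r, s). arcsine_density r s) =
      (\<lambda>p. if 0 < fst p \<and> fst p < snd p powr (1 / 2) then 2 / pi * (snd p - (fst p)\<^sup>2) powr (- 1 / 2) else 0)"
    by (auto simp: arcsine_density_def fun_eq_iff)
  also have "\<dots> \<in> borel_measurable (borel \<Otimes>\<^sub>M borel)"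
    by measurable
  finally show ?thesis .
qed

lemma arcsine_density_nonneg: "0 \<le> arcsine_density r s"
  by (simp add: arcsine_density_def)

lemma measurable_sgn [measurable]: "(sgn :: 'a::euclidean_space \<Rightarrow> 'a) \<in> borel_measurable borel"
  by (simp add: sgn_div_norm [abs_def])

lemma measurable_arcsine_avg [measurable]:
  assumes [measurable]: "f \<in> borel_measurable borel"
  shows "arcsine_avg f \<in> borel_measurable borel"
  unfolding arcsine_avg_def [abs_def] by measurable

lemma arcsine_set_fun_eq: "arcsine_set_fun \<nu> B = (\<integral>\<^sup>+ x\<in>- {0}. arcsine_avg (indicator B) x \<partial>\<nu>)"
  unfolding arcsine_set_fun_def arcsine_avg_def
  by (intro nn_integral_cong) (auto simp: sgn_div_norm Compl_eq_Diff_UNIV ac_simps)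

lemma arcsine_avg_SUP:
  assumes [measurable]: "\<And>i. U i \<in> borel_measurable borel" and "incseq U"
  shows "arcsine_avg (SUP i. U i) x = (SUP i. arcsine_avg (U i) x)"
proof -
  have inc: "incseq (\<lambda>i r. ennreal (arcsine_density r (norm x)) * indicator {0<..} r * U i (r *\<^sub>R sgn x))"
    using \<open>incseq U\<close> by (auto simp: mono_def le_fun_def intro!: mult_left_mono)
  show ?thesis
    unfolding arcsine_avg_def
    by (subst nn_integral_monotone_convergence_SUP [OF inc, symmetric])
       (auto simp: SUP_mult_left_ennreal image_comp)
qed

text \<open>
  The defining formula for sets extends to functions by the usual monotone class induction.
  This avoids exchanging the order of integration: the \<open>\<sigma>\<close>-finiteness of \<open>\<nu>\<close> that Fubini's theorem
  would require is known only once the tails of \<open>\<nu>\<close> have been shown to be finite.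
\<close>
lemma nn_integral_arcsine_transform:
  assumes \<nu>: "\<nu> \<in> arcsine_domain" and "f \<in> borel_measurable borel"
  shows "(\<integral>\<^sup>+ y. f y \<partial>arcsine_transform \<nu>) = (\<integral>\<^sup>+ x\<in>- {0}. arcsine_avg f x \<partial>\<nu>)"
proof -
  have [measurable_cong]: "sets \<nu> = sets borel" "sets (arcsine_transform \<nu>) = sets borel"
    using \<nu> by (auto simp: arcsine_domain_def sets_arcsine_transform)
  show ?thesis
    using assms(2)
  proof (induction rule: borel_measurable_induct)
    case (cong f g)
    then have "f = g" by (auto simp: space_borel)
    with cong show ?case by simp
  next
    case (set B)
    then have B: "B \<in> sets (arcsine_transform \<nu>)"
      by (simp add: sets_arcsine_transform)
    show ?case
      using set by (simp add: nn_integral_indicator [OF B] emeasure_arcsine_transform [OF \<nu>] arcsine_set_fun_eq)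
  next
    case (mult u c)
    note [measurable] = mult(2)
    have "arcsine_avg (\<lambda>y. c * u y) x = c * arcsine_avg u x" for x
      unfolding arcsine_avg_def
      by (subst nn_integral_cmult [symmetric]) (auto simp: ac_simps)
    then show ?case
      by (simp add: nn_integral_cmult mult.IH mult.assoc)
  next
    case (add u v)
    note [measurable] = add(1,3)
    have "arcsine_avg (\<lambda>y. v y + u y) x = arcsine_avg v x + arcsine_avg u x" for x
      unfolding arcsine_avg_def
      by (subst nn_integral_add [symmetric]) (auto simp: distrib_left)
    then show ?case
      by (simp add: nn_integral_add add.IH distrib_right)
  next
    case (seq U)
    note [measurable] = seq(1)
    have avg_mono: "arcsine_avg (U i) x \<le> arcsine_avg (U j) x" if "i \<le> j" for i j x
      unfolding arcsine_avg_def using \<open>incseq U\<close> that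
      by (intro nn_integral_mono mult_left_mono) (auto simp: mono_def le_fun_def)
    have "(\<integral>\<^sup>+ y. (SUP i. U i) y \<partial>arcsine_transform \<nu>) = (SUP i. \<integral>\<^sup>+ y. U i y \<partial>arcsine_transform \<nu>)"
      using \<open>incseq U\<close> by (simp add: nn_integral_monotone_convergence_SUP image_comp)
    also have "\<dots> = (SUP i. \<integral>\<^sup>+ x. arcsine_avg (U i) x * indicator (- {0}) x \<partial>\<nu>)"
      by (simp add: seq.IH)
    also have "\<dots> = (\<integral>\<^sup>+ x. (SUP i. arcsine_avg (U i) x * indicator (- {0}) x) \<partial>\<nu>)"
      using avg_mono
      by (intro nn_integral_monotone_convergence_SUP [symmetric])
         (auto simp: mono_def le_fun_def intro!: mult_right_mono)
    also have "\<dots> = (\<integral>\<^sup>+ x\<in>- {0}. arcsine_avg (SUP i. U i) x \<partial>\<nu>)"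
      by (simp add: arcsine_avg_SUP [OF seq(1) \<open>incseq U\<close>] SUP_mult_right_ennreal)
    finally show ?case .
  qed
qed

text \<open>
  Averaging runs along a ray, on which the direction is constant. It therefore acts only on the
  radial factor, and this reduces the inversion to one dimension.
\<close>
lemma arcsine_avg_radial:
  assumes "x \<noteq> 0"
  shows "arcsine_avg (\<lambda>y. g (norm y) * indicator C (sgn y)) x =
    (\<integral>\<^sup>+ r\<in>{0<..}. ennreal (arcsine_density r (norm x)) * g r \<partial>lborel) * indicator C (sgn x)"
proof -
  have "ennreal (arcsine_density r (norm x)) * indicator {0<..} r *
      (g (norm (r *\<^sub>R sgn x)) * indicator C (sgn (r *\<^sub>R sgn x))) =
    (ennreal (arcsine_density r (norm x)) * g r * indicator {0<..} r) * indicator C (sgn x)" for r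
  proof -
    have "sgn (sgn x) = sgn x" using assms by (simp add: sgn_div_norm)
    then show ?thesis
      using assms by (cases "0 < r") (auto simp: norm_sgn sgn_scaleR ac_simps)
  qed
  then show ?thesis
    unfolding arcsine_avg_def by (auto split: split_indicator)
qed

section \<open>Inversion by Abel's kernel\<close>

definition abel_kernel :: "real \<Rightarrow> real \<Rightarrow> real" where
  "abel_kernel t r = r * (r\<^sup>2 - t) powr (- 1 / 2) * indicator {sqrt t<..} r"

lemma measurable_abel_kernel [measurable]: "abel_kernel t \<in> borel_measurable borel"
  unfolding abel_kernel_def [abs_def] by measurable

text \<open>
  The substitution \<open>w = (2 r\<^sup>2 - s - t) / (s - t)\<close> maps \<open>(\<surd>t, \<surd>s)\<close> onto \<open>(-1, 1)\<close> and turns the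
  integral into \<open>\<integral> dw / (\<pi> \<surd>(1 - w\<^sup>2))\<close>. Hence \<open>arcsin w / \<pi>\<close> is an antiderivative. It is continuous
  up to the endpoints, where the integrand is singular, so the improper integral equals
  \<open>1/2 - (-1/2) = 1\<close>.
\<close>
lemma nn_integral_arcsine_density_abel_kernel:
  assumes "0 < t" "0 < s"
  shows "(\<integral>\<^sup>+ r\<in>{0<..}. ennreal (arcsine_density r s) * ennreal (abel_kernel t r) \<partial>lborel) = indicator {t<..} s"
proof -
  have vanish: "ennreal (arcsine_density r s) * ennreal (abel_kernel t r) = 0"
    if "\<not> (sqrt t < r \<and> r < sqrt s)" for r
    using that assms by (auto simp: arcsine_density_def abel_kernel_def powr_half_sqrt indicator_def)
  show ?thesis
  proof (cases "t < s")
    case False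
    then have "sqrt s \<le> sqrt t" by simp
    then have "ennreal (arcsine_density r s) * ennreal (abel_kernel t r) = 0" for r
      by (intro vanish) linarith
    then show ?thesis using False by (simp del: mult_eq_0_iff)
  next
    case True
    let ?f = "\<lambda>r. 2 / pi * r / (sqrt (s - r\<^sup>2) * sqrt (r\<^sup>2 - t))"
    let ?w = "\<lambda>r. (2 * r\<^sup>2 - s - t) / (s - t)"
    let ?F = "\<lambda>r. arcsin (?w r) / pi"
    have lt: "sqrt t < sqrt s" using True by simp
    have bds: "t < r\<^sup>2 \<and> r\<^sup>2 < s \<and> 0 < r" if "sqrt t < r" "r < sqrt s" for r
    proof -
      have "0 < r" using that(1) assms(1) by (meson less_trans real_sqrt_gt_zero)
      moreover have "(sqrt t)\<^sup>2 < r\<^sup>2" "r\<^sup>2 < (sqrt s)\<^sup>2"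
        using that assms \<open>0 < r\<close> by (simp_all only: power_strict_mono real_sqrt_ge_zero less_imp_le zero_less_numeral)
      ultimately show ?thesis using assms by simp
    qed
    have deriv: "(?F has_real_derivative ?f r) (at r)" if r: "sqrt t < r" "r < sqrt s" for r
    proof -
      note b = bds [OF r]
      have sq: "1 - (?w r)\<^sup>2 = (2 / (s - t))\<^sup>2 * ((s - r\<^sup>2) * (r\<^sup>2 - t))"
      proof -
        have "1 - (?w r)\<^sup>2 = ((s - t)\<^sup>2 - (2 * r\<^sup>2 - s - t)\<^sup>2) / (s - t)\<^sup>2"
          using True by (simp add: power_divide diff_divide_distrib [where a = "(s - t)\<^sup>2"])
        also have "(s - t)\<^sup>2 - (2 * r\<^sup>2 - s - t)\<^sup>2 = 4 * ((s - r\<^sup>2) * (r\<^sup>2 - t))"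
          by (simp add: power2_eq_square algebra_simps)
        finally show ?thesis by (simp add: power_divide)
      qed
      have w: "- 1 < ?w r" "?w r < 1" using b True by (auto simp: divide_simps)
      have "sqrt (1 - (?w r)\<^sup>2) = 2 / (s - t) * (sqrt (s - r\<^sup>2) * sqrt (r\<^sup>2 - t))"
        unfolding sq using True by (simp add: real_sqrt_mult)
      moreover have "(?F has_real_derivative inverse (sqrt (1 - (?w r)\<^sup>2)) * (4 * r / (s - t)) / pi) (at r)"
        using w True by (auto intro!: derivative_eq_intros)
      ultimately show ?thesis using True by (simp add: field_simps)
    qed
    have w_bound: "- 1 \<le> ?w r \<and> ?w r \<le> 1" if "r \<in> {sqrt t..sqrt s}" for r
    proof -
      have "0 \<le> r"
        using that assms(1) order_trans [OF real_sqrt_ge_zero, of t r] by simp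
      then have "(sqrt t)\<^sup>2 \<le> r\<^sup>2" "r\<^sup>2 \<le> (sqrt s)\<^sup>2"
        using that \<open>0 \<le> r\<close> assms by (simp_all only: power_mono real_sqrt_ge_zero less_imp_le atLeastAtMost_iff)
      then show ?thesis using assms True by (auto simp: divide_simps)
    qed
    have cont: "continuous_on {sqrt t..sqrt s} ?F"
      using True w_bound by (intro continuous_intros) auto
    have "?w (sqrt t) = - 1" "?w (sqrt s) = 1"
      using assms True by (auto simp: divide_simps)
    then have ends: "?F (sqrt t) = - 1 / 2" "?F (sqrt s) = 1 / 2"
      by (simp_all only:) simp_all
    have end1: "((?F \<circ> real_of_ereal) \<longlongrightarrow> - 1 / 2) (at_right (ereal (sqrt t)))"
      using continuous_on_Icc_at_rightD [OF cont lt] unfolding ends ereal_tendsto_simps .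
    have end2: "((?F \<circ> real_of_ereal) \<longlongrightarrow> 1 / 2) (at_left (ereal (sqrt s)))"
      using continuous_on_Icc_at_leftD [OF cont lt] unfolding ends ereal_tendsto_simps .
    have f_cont: "isCont ?f r" if r: "sqrt t < r" "r < sqrt s" for r
      using bds [OF r] by (intro continuous_intros) auto
    have f_nonneg: "0 \<le> ?f r" if r: "sqrt t < r" "r < sqrt s" for r
      using bds [OF r] by simp
    have ae: "AE r in lborel. ereal (sqrt t) < ereal r \<longrightarrow> ereal r < ereal (sqrt s) \<longrightarrow> 0 \<le> ?f r"
      using f_nonneg by simp
    have lt': "ereal (sqrt t) < ereal (sqrt s)" using lt by simp
    have ftc: "set_integrable lborel {sqrt t<..<sqrt s} ?f"
      using interval_integral_FTC_nonneg(1) [OF lt' _ _ ae end1 end2] deriv f_cont by simp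
    have "(LBINT r=ereal (sqrt t)..ereal (sqrt s). ?f r) = 1"
      using interval_integral_FTC_nonneg(2) [OF lt' _ _ ae end1 end2] deriv f_cont by simp
    then have int: "(LBINT r:{sqrt t<..<sqrt s}. ?f r) = 1"
      using lt by (simp add: interval_lebesgue_integral_def)
    have "ennreal (arcsine_density r s) * ennreal (abel_kernel t r) * indicator {0<..} r =
        ennreal (indicator {sqrt t<..<sqrt s} r *\<^sub>R ?f r)" for r
    proof (cases "sqrt t < r \<and> r < sqrt s")
      case True
      note b = bds [of r]
      have "arcsine_density r s * abel_kernel t r = ?f r"
        using True b assms
        by (simp add: arcsine_density_def abel_kernel_def powr_half_sqrt powr_minus_divide)
      then show ?thesis
        using True b by (simp add: ennreal_mult' [symmetric] arcsine_density_nonneg)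
    next
      case False
      then show ?thesis using vanish [OF False] by auto
    qed
    then have "(\<integral>\<^sup>+ r\<in>{0<..}. ennreal (arcsine_density r s) * ennreal (abel_kernel t r) \<partial>lborel) =
       (\<integral>\<^sup>+ r. ennreal (indicator {sqrt t<..<sqrt s} r *\<^sub>R ?f r) \<partial>lborel)"
      by simp
    also have "\<dots> = ennreal (LBINT r:{sqrt t<..<sqrt s}. ?f r)"
      unfolding set_lebesgue_integral_def
      using ftc f_nonneg unfolding set_integrable_def
      by (intro nn_integral_eq_integral) (auto split: split_indicator)
    finally show ?thesis using True int by simp
  qed
qed

text \<open>
  The inversion formula: the left-hand side depends on \<open>\<nu>\<close> only through its transform. It combines
  the one-dimensional identity on each ray with the fact that the direction is preserved.
\<close>
lemma nn_integral_abel_kernel_arcsine_transform: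
  assumes \<nu>: "\<nu> \<in> arcsine_domain" and t: "0 < t" and C [measurable]: "C \<in> sets borel"
  shows "(\<integral>\<^sup>+ y. ennreal (abel_kernel t (norm y)) * indicator C (sgn y) \<partial>arcsine_transform \<nu>) =
    emeasure \<nu> {x. t < norm x \<and> sgn x \<in> C}"
proof -
  have sets [measurable_cong]: "sets \<nu> = sets borel"
    using \<nu> by (simp add: arcsine_domain_def)
  have "(\<integral>\<^sup>+ y. ennreal (abel_kernel t (norm y)) * indicator C (sgn y) \<partial>arcsine_transform \<nu>) =
      (\<integral>\<^sup>+ x\<in>- {0}. arcsine_avg (\<lambda>y. ennreal (abel_kernel t (norm y)) * indicator C (sgn y)) x \<partial>\<nu>)"
    by (rule nn_integral_arcsine_transform [OF \<nu>]) measurable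
  also have "\<dots> = (\<integral>\<^sup>+ x. indicator {x. t < norm x \<and> sgn x \<in> C} x \<partial>\<nu>)"
  proof (rule nn_integral_cong)
    fix x :: 'a
    show "arcsine_avg (\<lambda>y. ennreal (abel_kernel t (norm y)) * indicator C (sgn y)) x * indicator (- {0}) x =
        indicator {x. t < norm x \<and> sgn x \<in> C} x"
    proof (cases "x = 0")
      case False
      then have "arcsine_avg (\<lambda>y. ennreal (abel_kernel t (norm y)) * indicator C (sgn y)) x =
          indicator {t<..} (norm x) * indicator C (sgn x)"
        using t by (simp add: arcsine_avg_radial [where g = "\<lambda>r. ennreal (abel_kernel t r)"]
          nn_integral_arcsine_density_abel_kernel)
      then show ?thesis using False by (auto split: split_indicator)
    qed (use t in simp)
  qed
  also have "\<dots> = emeasure \<nu> {x. t < norm x \<and> sgn x \<in> C}"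
    by (rule nn_integral_indicator) (simp add: sets)
  finally show ?thesis .
qed

section \<open>Finiteness of the tails\<close>

text \<open>
  With \<open>s = |x|\<close>, the density increases on \<open>(0, \<surd>s)\<close> from its limit \<open>2/(\<pi>\<surd>s)\<close> at the origin.
  Hence \<open>(\<surd>s/2, \<surd>s)\<close>, an interval of length \<open>\<surd>s/2\<close>, carries mass at least \<open>1/\<pi>\<close>. There \<open>r\<^sup>2 > s/4 > t/4\<close>.
\<close>
lemma arcsine_avg_min_lower_bound:
  assumes t: "0 < t" "t < norm x"
  shows "ennreal (min 1 (t / 4) / pi) \<le> arcsine_avg (\<lambda>y. ennreal (min 1 ((norm y)\<^sup>2))) x"
proof -
  define s where "s = norm x"
  have s: "0 < s" "t < s" using t by (auto simp: s_def)
  have x: "norm (sgn x) = 1" using t by (auto simp: norm_sgn)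
  have low: "2 / pi / sqrt s * min 1 (t / 4) \<le> arcsine_density r s * min 1 (r\<^sup>2)"
    if r: "r \<in> {sqrt s / 2<..<sqrt s}" for r
  proof -
    have r0: "0 < r" using r s by (smt (verit) greaterThanLessThan_iff half_gt_zero real_sqrt_gt_zero)
    have "(sqrt s / 2)\<^sup>2 < r\<^sup>2" "r\<^sup>2 < (sqrt s)\<^sup>2"
      using power_strict_mono [of "sqrt s / 2" r 2] power_strict_mono [of r "sqrt s" 2] r s r0
      by (simp_all del: real_sqrt_pow2)
    then have sq: "s / 4 < r\<^sup>2" "r\<^sup>2 < s" using s by (auto simp: power_divide)
    have "2 / pi / sqrt s \<le> 2 / pi / sqrt (s - r\<^sup>2)"
      using sq s by (intro divide_left_mono) auto
    also have "\<dots> = arcsine_density r s"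
      using r r0 sq s by (simp add: arcsine_density_def powr_half_sqrt powr_minus_divide)
    finally have "2 / pi / sqrt s \<le> arcsine_density r s" .
    then show ?thesis
      using sq s t by (intro mult_mono) (auto simp: arcsine_density_nonneg)
  qed
  have "ennreal (min 1 (t / 4) / pi) =
      ennreal (2 / pi / sqrt s * min 1 (t / 4)) * emeasure lborel {sqrt s / 2<..<sqrt s}"
    using s t by (simp add: ennreal_mult' [symmetric])
  also have "\<dots> = (\<integral>\<^sup>+ r. ennreal (2 / pi / sqrt s * min 1 (t / 4)) * indicator {sqrt s / 2<..<sqrt s} r \<partial>lborel)"
    by (rule nn_integral_cmult_indicator [symmetric]) simp
  also have "\<dots> \<le> (\<integral>\<^sup>+ r. ennreal (arcsine_density r (norm x)) * indicator {0<..} r *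
      ennreal (min 1 ((norm (r *\<^sub>R sgn x))\<^sup>2)) \<partial>lborel)"
  proof (rule nn_integral_mono)
    fix r :: real
    show "ennreal (2 / pi / sqrt s * min 1 (t / 4)) * indicator {sqrt s / 2<..<sqrt s} r \<le>
      ennreal (arcsine_density r (norm x)) * indicator {0<..} r * ennreal (min 1 ((norm (r *\<^sub>R sgn x))\<^sup>2))"
    proof (cases "r \<in> {sqrt s / 2<..<sqrt s}")
      case True
      then have "0 < r" using s by (smt (verit) greaterThanLessThan_iff half_gt_zero real_sqrt_gt_zero)
      then show ?thesis
        using True low [OF True] x
        by (simp add: s_def [symmetric] ennreal_mult' [symmetric] arcsine_density_nonneg ennreal_leI)
    qed simp
  qed
  finally show ?thesis unfolding arcsine_avg_def .
qed

lemma arcsine_domain_tail_finite: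
  assumes \<nu>: "\<nu> \<in> arcsine_domain" and t: "0 < t"
  shows "emeasure \<nu> {x. t < norm x} < \<infinity>"
proof -
  have sets [measurable_cong]: "sets \<nu> = sets borel"
    using \<nu> by (simp add: arcsine_domain_def)
  let ?c = "ennreal (min 1 (t / 4) / pi)"
  have "?c * emeasure \<nu> {x. t < norm x} = (\<integral>\<^sup>+ x. ?c * indicator {x. t < norm x} x \<partial>\<nu>)"
    by (rule nn_integral_cmult_indicator [symmetric]) (simp add: sets)
  also have "\<dots> \<le> (\<integral>\<^sup>+ x\<in>- {0}. arcsine_avg (\<lambda>y. ennreal (min 1 ((norm y)\<^sup>2))) x \<partial>\<nu>)"
    using t arcsine_avg_min_lower_bound [OF t]
    by (intro nn_integral_mono) (auto simp: indicator_def)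
  also have "\<dots> = (\<integral>\<^sup>+ y. ennreal (min 1 ((norm y)\<^sup>2)) \<partial>arcsine_transform \<nu>)"
    by (rule nn_integral_arcsine_transform [OF \<nu>, symmetric]) measurable
  also have "\<dots> < \<infinity>"
    using \<nu> by (simp add: arcsine_domain_def levy_measures_def)
  finally have "?c * emeasure \<nu> {x. t < norm x} < \<infinity>" .
  moreover have "?c \<noteq> 0"
    using t by (simp add: ennreal_eq_0_iff not_le)
  ultimately show ?thesis
    by (auto simp: ennreal_mult_less_top)
qed

section \<open>Uniqueness from polar tails\<close>

text \<open>
  Logarithmic polar coordinates \<open>x \<mapsto> (ln |x|, x/|x|)\<close> turn the tails into the rectangles
  \<open>{a<..} \<times> C\<close> with arbitrary real \<open>a\<close>. These form a \<open>\<pi>\<close>-system that generates the product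
  \<open>\<sigma>\<close>-algebra, and \<open>{-n<..} \<times> UNIV\<close> exhausts the space by sets of finite mass. The measure
  on the Euclidean space is recovered by mapping back with \<open>(l, u) \<mapsto> e\<^sup>l u\<close>.
\<close>
lemma measure_eq_polar_tails:
  fixes M N :: "'a::euclidean_space measure"
  assumes M: "sets M = sets borel" "emeasure M {0} = 0"
    and N: "sets N = sets borel" "emeasure N {0} = 0"
    and eq: "\<And>t C. 0 < t \<Longrightarrow> C \<in> sets borel \<Longrightarrow>
      emeasure M {x. t < norm x \<and> sgn x \<in> C} = emeasure N {x. t < norm x \<and> sgn x \<in> C}"
    and fin: "\<And>t. 0 < t \<Longrightarrow> emeasure M {x. t < norm x} < \<infinity>"
  shows "M = N"
proof -
  note [measurable_cong] = M(1) N(1)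
  define \<phi> :: "'a \<Rightarrow> real \<times> 'a" where "\<phi> x = (ln (norm x), sgn x)" for x
  define \<psi> :: "real \<times> 'a \<Rightarrow> 'a" where "\<psi> p = exp (fst p) *\<^sub>R snd p" for p
  have [measurable]: "\<phi> \<in> borel \<rightarrow>\<^sub>M borel \<Otimes>\<^sub>M borel" "\<psi> \<in> borel \<Otimes>\<^sub>M borel \<rightarrow>\<^sub>M borel"
    unfolding \<phi>_def [abs_def] \<psi>_def [abs_def] by measurable
  \<comment> \<open>At the origin this uses \<open>ln 0 = 0\<close> and \<open>sgn 0 = 0\<close>: then \<open>\<phi> 0 = (0, 0)\<close> and \<open>\<psi> (0, 0) = 0\<close>.\<close>
  have inv: "\<psi> (\<phi> x) = x" for x
    by (cases "x = 0") (auto simp: \<phi>_def \<psi>_def sgn_div_norm)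
  have polar: "emeasure (distr L (borel \<Otimes>\<^sub>M borel) \<phi>) ({a<..} \<times> C) =
      emeasure L {x. exp a < norm x \<and> sgn x \<in> C}"
    if L: "sets L = sets borel" "emeasure L {0} = 0" and C: "C \<in> sets borel" for L :: "'a measure" and a C
  proof -
    note [measurable_cong] = L(1) and [measurable] = C
    have sp: "space L = UNIV" using L(1) sets_eq_imp_space_eq by fastforce
    \<comment> \<open>Since \<open>ln 0 = 0\<close>, the preimage of a rectangle with \<open>a < 0\<close> may contain the origin, which
      no tail does. The origin is a null set.\<close>
    have "{0} \<in> null_sets L" using L by (auto simp: null_sets_def)
    then have "AE x in L. x \<noteq> 0" by (rule AE_I') auto
    have "emeasure (distr L (borel \<Otimes>\<^sub>M borel) \<phi>) ({a<..} \<times> C) = emeasure L {x \<in> space L. a < ln (norm x) \<and> sgn x \<in> C}"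
      by (subst emeasure_distr) (auto simp: \<phi>_def intro!: arg_cong [where f = "emeasure L"])
    also have "\<dots> = emeasure L {x \<in> space L. exp a < norm x \<and> sgn x \<in> C}"
    proof (rule emeasure_eq_AE)
      show "AE x in L. (x \<in> {x \<in> space L. a < ln (norm x) \<and> sgn x \<in> C}) \<longleftrightarrow>
          (x \<in> {x \<in> space L. exp a < norm x \<and> sgn x \<in> C})"
        using \<open>AE x in L. x \<noteq> 0\<close>
      proof eventually_elim
        case (elim x)
        then have "a < ln (norm x) \<longleftrightarrow> exp a < norm x"
          using exp_less_cancel_iff [of a "ln (norm x)"] by simp
        then show ?case by simp
      qed
    qed measurable
    finally show ?thesis by (simp add: sp)
  qed
  let ?E = "{A \<times> C | A C. A \<in> range greaterThan \<and> C \<in> sets borel} :: (real \<times> 'a) set set"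
  have sets_E: "sets (borel \<Otimes>\<^sub>M borel :: (real \<times> 'a) measure) = sigma_sets UNIV ?E"
  proof -
    have "sets (borel \<Otimes>\<^sub>M borel :: (real \<times> 'a) measure) =
        sets (sigma (space borel \<times> space borel) ?E)"
    proof (rule sets_pair_eq)
      show "sets (borel :: real measure) = sigma_sets (space borel) (range greaterThan)"
        by (simp add: borel_Ioi)
      show "sets (borel :: 'a measure) = sigma_sets (space borel) (sets borel)"
        by (metis sets.sigma_sets_eq)
      show "countable (range (\<lambda>n::nat. {- real n<..}))" by simp
      show "\<Union> (range (\<lambda>n::nat. {- real n<..})) = space borel"
        by (auto simp: minus_less_iff) (meson minus_less_iff reals_Archimedean2)
      show "countable {UNIV :: 'a set}" by simp
    qed auto
    then show ?thesis by simp
  qed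
  have "distr M (borel \<Otimes>\<^sub>M borel) \<phi> = distr N (borel \<Otimes>\<^sub>M borel) \<phi>"
  proof (rule measure_eqI_generator_eq)
    show "Int_stable ?E"
    proof (rule Int_stableI)
      fix X Y assume "X \<in> ?E" "Y \<in> ?E"
      then obtain a b C D where XY: "X = {a<..} \<times> C" "Y = {b<..} \<times> D" "C \<in> sets borel" "D \<in> sets borel"
        by auto
      then have "X \<inter> Y = {max a b<..} \<times> (C \<inter> D)" by auto
      with XY show "X \<inter> Y \<in> ?E" by blast
    qed
    show "emeasure (distr M (borel \<Otimes>\<^sub>M borel) \<phi>) X = emeasure (distr N (borel \<Otimes>\<^sub>M borel) \<phi>) X" if "X \<in> ?E" for X
      using that eq by (auto simp: polar M N)
    show "range (\<lambda>n::nat. {- real n<..} \<times> UNIV) \<subseteq> ?E"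
    proof (rule image_subsetI)
      show "{- real n<..} \<times> UNIV \<in> ?E" for n
        using sets.top [of "borel :: 'a measure"] unfolding space_borel by blast
    qed
    show "(\<Union>n::nat. {- real n<..} \<times> (UNIV :: 'a set)) = UNIV"
      by (auto simp: minus_less_iff) (meson minus_less_iff reals_Archimedean2)
    show "emeasure (distr M (borel \<Otimes>\<^sub>M borel) \<phi>) ({- real n<..} \<times> UNIV) \<noteq> \<infinity>" for n
      using fin [of "exp (- real n)"] by (simp add: polar M)
  qed (use sets_E in auto)
  then have "distr (distr M (borel \<Otimes>\<^sub>M borel) \<phi>) borel \<psi> = distr (distr N (borel \<Otimes>\<^sub>M borel) \<phi>) borel \<psi>"
    by simp
  then have "distr M borel (\<lambda>x. x) = distr N borel (\<lambda>x. x)"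
    by (simp add: distr_distr o_def inv)
  then show "M = N"
    by (simp add: distr_id2 M N)
qed

theorem theorem2p4:
  shows "inj_on arcsine_transform (arcsine_domain :: 'a::euclidean_space measure set)"
proof (rule inj_onI)
  fix \<nu> \<nu>' :: "'a measure"
  assume \<nu>: "\<nu> \<in> arcsine_domain" and \<nu>': "\<nu>' \<in> arcsine_domain"
    and eq: "arcsine_transform \<nu> = arcsine_transform \<nu>'"
  show "\<nu> = \<nu>'"
  proof (rule measure_eq_polar_tails)
    show "emeasure \<nu> {x. t < norm x \<and> sgn x \<in> C} = emeasure \<nu>' {x. t < norm x \<and> sgn x \<in> C}"
      if "0 < t" "C \<in> sets borel" for t C
      using nn_integral_abel_kernel_arcsine_transform [OF \<nu> that]
        nn_integral_abel_kernel_arcsine_transform [OF \<nu>' that] by (simp add: eq)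
    show "emeasure \<nu> {x. t < norm x} < \<infinity>" if "0 < t" for t
      using \<nu> that by (rule arcsine_domain_tail_finite)
  qed (use \<nu> \<nu>' in \<open>auto simp: arcsine_domain_def\<close>)
qed

end
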